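(* Let $g>0$, $C=0.6\sqrt g$, and let $H^->0$, $H^+>0$ be the heights of the weir on its left and right side. For all states $(h_l,v_l)$ and $(h_r,v_r)$ in the subsonic region $\{(h,v): h>0,\ |v|<\sqrt{gh}\}$, the Riemann problem at the weir with initial data $(h,v)(0,x)=(h_l,v_l)$ for $x<0$ and $(h,v)(0,x)=(h_r,v_r)$ for $x>0$ has a unique solution in the sense of the definition given in the context, whose constant states depend continuously on the initial data and are constructed by glueing together a wave of the first family, the coupling condition and a wave of the second family. That is, with $(h^\pm,v^\pm)=(h,v)(t,0\pm)$, the state $(h_l,v_l)$ is joined to $(h^-,v^-)$ by a wave of the first family, the states $(h^-,v^-)$ and $(h^+,v^+)$ satisfy the coupling condition, and $(h^+,v^+)$ is joined to $(h_r,v_r)$ by a wave of the second family.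
   Context: **Equations.** The water height $h>0$ and velocity $v$ satisfy the shallow water equations on each side of the weir located at $x=0$: $$\partial_t h+\partial_x(hv)=0,\qquad \partial_t(hv)+\partial_x\left(hv^2+\tfrac12 g h^2\right)=0,\qquad x\neq 0.$$ This is a $2\times2$ system of conservation laws in the conserved variables $(h,hv)$. **Coupling condition.** Write $[a]_+=\max\{a,0\}$. The traces $(h^\pm,v^\pm)=(h,v)(t,0\pm)$ satisfy the coupling condition if $$h^-v^- = C\left([h^--H^-]_+-[h^+-H^+]_+\right)\sqrt{\left|[h^--H^-]_+-[h^+-H^+]_+\right|},\qquad h^+v^+=h^-v^-.$$ **Waves.** The characteristic speeds are $\lambda_1=v-\sqrt{gh}$ and $\lambda_2=v+\sqrt{gh}$, and both characteristic fields are genuinely nonlinear. A left state $(h_0,v_0)$ is joined to a right state $(h,v)$ by a wave of the first family if $v=\mathcal L_1^+(h;h_0,v_0)$, where $$\mathcal L_1^+(h;h_0,v_0)=\begin{cases} v_0-2(\sqrt{gh}-\sqrt{gh_0}) & h\le h_0 \ \text{(rarefaction)}\\ v_0-(h-h_0)\sqrt{\tfrac12 g\frac{h+h_0}{hh_0}} & h>h_0\ \text{(shock)}.\end{cases}$$ It is joined by a wave of the second family if $v=\mathcal L_2^+(h;h_0,v_0)$, where $$\mathcal L_2^+(h;h_0,v_0)=\begin{cases} v_0+2(\sqrt{gh}-\sqrt{gh_0}) & h\ge h_0 \ \text{(rarefaction)}\\ v_0+(h-h_0)\sqrt{\tfrac12 g\frac{h+h_0}{hh_0}} & h<h_0\ \text{(shock)}.\end{cases}$$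 The Lax solution of a standard Riemann problem (no weir) is the usual self-similar entropy solution made of a wave of the first family followed by a wave of the second family. **Definition (solution of the Riemann problem at the weir).** A solution with data $(h_l,v_l)$ for $x<0$ and $(h_r,v_r)$ for $x>0$ is a self-similar function $(h,v):\mathbb R^+\times\mathbb R\to\mathbb R^2$ such that: - in $x>0$ it coincides with the restriction to $x>0$ of the Lax solution of the standard Riemann problem for the shallow water equations with data $(h,v)(t,0+)$ for $x<0$ and $(h_r,v_r)$ for $x>0$; - in $x<0$ it coincides with the restriction to $x<0$ of the Lax solution of the standard Riemann problem with data $(h_l,v_l)$ for $x<0$ and $(h,v)(t,0-)$ for $x>0$; - the traces $(h,v)(t,0\pm)=(h^\pm,v^\pm)$ satisfy the coupling condition.
   Formalization: Uniqueness is stated among solutions built by glueing a 1-wave, the coupling condition and a 2-wave, or having both traces subsonic; among all solutions of the definition it fails (e.g. g=1, H±=1, data (2,0),(4,0)), since a 2-shock of negative speed may reach a supersonic left trace. *)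

theory Defs
  imports "HOL-Analysis.Analysis"
begin

text \<open>A state \<open>(h, v)\<close> is a pair of a water height and a velocity; \<open>g\<close> is the gravity constant.\<close>

type_synonym state = "real \<times> real"

definition subsonic :: "real \<Rightarrow> state set" where
  "subsonic g = {(h, v). h > 0 \<and> \<bar>v\<bar> < sqrt (g * h)}"

fun lam1 :: "real \<Rightarrow> state \<Rightarrow> real" where
  "lam1 g (h, v) = v - sqrt (g * h)"

fun lam2 :: "real \<Rightarrow> state \<Rightarrow> real" where
  "lam2 g (h, v) = v + sqrt (g * h)"

definition L1 :: "real \<Rightarrow> real \<Rightarrow> real \<Rightarrow> real \<Rightarrow> real" where
  "L1 g h h0 v0 =
     (if h \<le> h0 then v0 - 2 * (sqrt (g * h) - sqrt (g * h0))
      else v0 - (h - h0) * sqrt (1/2 * g * ((h + h0) / (h * h0))))"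

definition L2 :: "real \<Rightarrow> real \<Rightarrow> real \<Rightarrow> real \<Rightarrow> real" where
  "L2 g h h0 v0 =
     (if h \<ge> h0 then v0 + 2 * (sqrt (g * h) - sqrt (g * h0))
      else v0 + (h - h0) * sqrt (1/2 * g * ((h + h0) / (h * h0))))"

text \<open>The first state is the left one, the second state the right one; the trivial wave
  (equal states) is included in both families.\<close>

fun joined1 :: "real \<Rightarrow> state \<Rightarrow> state \<Rightarrow> bool" where
  "joined1 g (h0, v0) (h, v) \<longleftrightarrow> v = L1 g h h0 v0"

fun joined2 :: "real \<Rightarrow> state \<Rightarrow> state \<Rightarrow> bool" where
  "joined2 g (h0, v0) (h, v) \<longleftrightarrow> v = L2 g h h0 v0"

text \<open>Rankine--Hugoniot speed of a shock (first component of the system); only used for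
  states with different heights.\<close>

fun shock_speed :: "state \<Rightarrow> state \<Rightarrow> real" where
  "shock_speed (h0, v0) (h, v) = (h * v - h0 * v0) / (h - h0)"

text \<open>The state inside a centred rarefaction fan issuing from the left state \<open>(h0, v0)\<close>, as a
  function of \<open>\<xi> = x / t\<close>.  First family: \<open>v - sqrt (g h) = \<xi>\<close> with \<open>v + 2 sqrt (g h)\<close> constant.
  Second family: \<open>v + sqrt (g h) = \<xi>\<close> with \<open>v - 2 sqrt (g h)\<close> constant.\<close>

fun fan1 :: "real \<Rightarrow> state \<Rightarrow> real \<Rightarrow> state" where
  "fan1 g (h0, v0) \<xi> =
     (let c = (v0 + 2 * sqrt (g * h0) - \<xi>) / 3 in (c\<^sup>2 / g, \<xi> + c))"

fun fan2 :: "real \<Rightarrow> state \<Rightarrow> real \<Rightarrow> state" where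
  "fan2 g (h0, v0) \<xi> =
     (let c = (\<xi> - v0 + 2 * sqrt (g * h0)) / 3 in (c\<^sup>2 / g, \<xi> - c))"

text \<open>Profile, as a function of \<open>\<xi> = x / t\<close>, of a single wave from the left state \<open>a\<close> to the
  right state \<open>b\<close>.  Throughout, the representative that is continuous from the right
  in \<open>x\<close> is used; this only concerns the values on shock lines.\<close>

definition wave1 :: "real \<Rightarrow> state \<Rightarrow> state \<Rightarrow> real \<Rightarrow> state" where
  "wave1 g a b \<xi> =
     (if fst b \<le> fst a
      then (if \<xi> < lam1 g a then a else if \<xi> < lam1 g b then fan1 g a \<xi> else b)
      else (if \<xi> < shock_speed a b then a else b))"

definition wave2 :: "real \<Rightarrow> state \<Rightarrow> state \<Rightarrow> real \<Rightarrow> state" where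
  "wave2 g a b \<xi> =
     (if fst b \<ge> fst a
      then (if \<xi> < lam2 g a then a else if \<xi> < lam2 g b then fan2 g a \<xi> else b)
      else (if \<xi> < shock_speed a b then a else b))"

text \<open>\<open>lax_solution g a b U\<close>: the function \<open>U t x\<close> (\<open>t \<ge> 0\<close>) is the Lax solution of the standard
  Riemann problem with left datum \<open>a\<close> and right datum \<open>b\<close>: a 1-wave from \<open>a\<close> to a middle
  state \<open>m\<close>, then a 2-wave from \<open>m\<close> to \<open>b\<close>.  All wave speeds of the 1-wave lie below the
  velocity \<open>snd m\<close> of the middle state and all those of the 2-wave above it, so that the two
  profiles can be cut at \<open>x / t = snd m\<close>.  At \<open>t = 0\<close> the solution takes the initial data.\<close>

definition lax_solution :: "real \<Rightarrow> state \<Rightarrow> state \<Rightarrow> (real \<Rightarrow> real \<Rightarrow> state) \<Rightarrow> bool" where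
  "lax_solution g a b U \<longleftrightarrow>
     (\<exists>m. fst m > 0 \<and> joined1 g a m \<and> joined2 g m b \<and>
        (\<forall>x. U 0 x = (if x < 0 then a else b)) \<and>
        (\<forall>t>0. \<forall>x. U t x =
            (if x / t < snd m then wave1 g a m (x / t) else wave2 g m b (x / t))))"

definition pos_part :: "real \<Rightarrow> real" where
  "pos_part a = max a 0"

fun coupling :: "real \<Rightarrow> real \<Rightarrow> real \<Rightarrow> state \<Rightarrow> state \<Rightarrow> bool" where
  "coupling C Hm Hp (hm, vm) (hp, vp) \<longleftrightarrow>
     hm * vm = C * (pos_part (hm - Hm) - pos_part (hp - Hp)) *
               sqrt \<bar>pos_part (hm - Hm) - pos_part (hp - Hp)\<bar> \<and>
     hp * vp = hm * vm"

definition self_similar :: "(real \<Rightarrow> real \<Rightarrow> state) \<Rightarrow> bool" where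
  "self_similar u \<longleftrightarrow> (\<forall>t>0. \<forall>x. \<forall>a>0. u (a * t) (a * x) = u t x)"

text \<open>\<open>weir_solution g C Hm Hp wl wr u wm wp\<close>: \<open>u t x\<close> is a solution of the Riemann problem at the
  weir with data \<open>wl\<close>, \<open>wr\<close>, and \<open>wm\<close>, \<open>wp\<close> are its traces at \<open>x = 0-\<close> and \<open>x = 0+\<close>.  The Lax
  solutions used here are allowed to contain waves of both families.\<close>

definition weir_solution ::
  "real \<Rightarrow> real \<Rightarrow> real \<Rightarrow> real \<Rightarrow> state \<Rightarrow> state \<Rightarrow> (real \<Rightarrow> real \<Rightarrow> state) \<Rightarrow> state \<Rightarrow> state \<Rightarrow> bool" where
  "weir_solution g C Hm Hp wl wr u wm wp \<longleftrightarrow>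
     self_similar u \<and> fst wm > 0 \<and> fst wp > 0 \<and>
     (\<forall>t>0. (u t \<longlongrightarrow> wm) (at_left 0)) \<and>
     (\<forall>t>0. (u t \<longlongrightarrow> wp) (at_right 0)) \<and>
     (\<exists>U. lax_solution g wp wr U \<and> (\<forall>t\<ge>0. \<forall>x>0. u t x = U t x)) \<and>
     (\<exists>U. lax_solution g wl wm U \<and> (\<forall>t\<ge>0. \<forall>x<0. u t x = U t x)) \<and>
     coupling C Hm Hp wm wp"

text \<open>1-wave, coupling condition and 2-wave glued together.  This is an extra requirement on a
  \<open>weir_solution\<close>: a supercritical trace on the downstream side may also be reached through a
  2-wave of negative speed on the left (or a 1-wave of positive speed on the right), and
  uniqueness fails if such solutions are admitted.\<close>

definition glued :: "real \<Rightarrow> real \<Rightarrow> real \<Rightarrow> real \<Rightarrow> state \<Rightarrow> state \<Rightarrow> state \<Rightarrow> state \<Rightarrow> bool" where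
  "glued g C Hm Hp wl wr wm wp \<longleftrightarrow>
     joined1 g wl wm \<and> coupling C Hm Hp wm wp \<and> joined2 g wp wr"

end

theory Submission
  imports Defs
begin

text \<open>The whole problem reduces to one scalar equation for the discharge \<open>q = h v\<close> through the weir.

The trace at \<open>0-\<close> lies on the 1-wave curve \<open>h \<mapsto> (h, L1 h)\<close> of the left datum.  Along this curve
the discharge \<open>h \<cdot> L1 h\<close> increases up to a critical (sonic) height \<open>h\<^sub>*\<close>, where \<open>\<lambda>\<^sub>1 = 0\<close>, and strictly
decreases to \<open>-\<infinity>\<close> afterwards, because its derivative there has the sign of the wave speed
(\<open>flux1_strict_decreasing\<close>).  As the left datum is subsonic, a 1-wave stays in \<open>x < 0\<close> and has its
right state as trace exactly when that state lies on the decreasing branch \<open>h \<ge> h\<^sub>*\<close>; so the height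
of the left trace is a strictly decreasing function of \<open>q\<close>.  The reflection
\<open>(x, v) \<mapsto> (-x, -v)\<close> exchanges the two families, hence the height of the right trace is strictly
increasing in \<open>q\<close>.

In the coupling condition \<open>q = C (\<delta> \<surd>\<bar>\<delta>\<bar>)\<close>, with \<open>\<delta>\<close> the difference of the two overflow heights, the
right-hand side is thus nonincreasing in \<open>q\<close> and there is at most one solution.  For existence,
let \<open>Q = h\<^sub>* \<surd>(g h\<^sub>*)\<close> be the largest discharge that the left datum permits.  At \<open>q = Q\<close> we have
\<open>\<delta> \<le> h\<^sub>*\<close>, and since \<open>C < \<surd>g\<close> the right-hand side is at most \<open>C h\<^sub>* \<surd>h\<^sub>* < Q\<close> (\<open>residual_sonic_pos\<close>).
The mirror image of this bound handles the other end of the admissible interval, and the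
intermediate value theorem applies.  The same strict bounds put the two traces off the sonic
points.  Continuous dependence holds because both the height as a function of \<open>q\<close> and then \<open>q\<close>
itself are zeros of strictly monotone functions that depend continuously on the data
(\<open>continuous_on_root\<close>).

It remains to see that every solution in the sense of the definition, glued or with subsonic
traces, has traces on these branches.  The one-sided limit at \<open>x = 0\<close> of a Lax solution is a state on
one of its waves: the middle state or a critical state inside a fan.  A critical state is not
subsonic, and a glued trace has to be the middle state, since the middle state is unique
(\<open>left_trace_admissible\<close>).\<close>

section \<open>Zeros of monotone functions with a parameter\<close>

text \<open>No joint continuity is required: if \<open>F p\<close> changes sign between \<open>r p - \<epsilon>\<close> and \<open>r p + \<epsilon>\<close>, then so does
\<open>F p'\<close> for \<open>p'\<close> near \<open>p\<close>, by continuity at these two fixed arguments only, and monotonicity traps \<open>r p'\<close>.\<close>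

lemma continuous_on_root:
  fixes F :: "'a::topological_space \<Rightarrow> real \<Rightarrow> real"
  assumes cont: "\<And>y. continuous_on S (\<lambda>p. F p y)"
    and mono: "\<And>p. p \<in> S \<Longrightarrow> strict_mono (F p)"
    and root: "\<And>p. p \<in> S \<Longrightarrow> F p (r p) = 0"
  shows "continuous_on S r"
  unfolding continuous_on_def
proof
  fix p assume p: "p \<in> S"
  have lim: "((\<lambda>p. F p y) \<longlongrightarrow> F p y) (at p within S)" for y
    using cont p by (auto simp: continuous_on_def)
  have inS: "\<forall>\<^sub>F x in at p within S. x \<in> S"
    by (simp add: eventually_at_filter)
  show "(r \<longlongrightarrow> r p) (at p within S)"
  proof (rule order_tendstoI)
    fix a assume "a < r p"
    then have "F p a < 0" using mono[OF p] root[OF p] by (metis strict_mono_less)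
    from order_tendstoD(2)[OF lim this] inS
    show "\<forall>\<^sub>F x in at p within S. a < r x"
      by eventually_elim (metis mono root strict_mono_less)
  next
    fix a assume "r p < a"
    then have "0 < F p a" using mono[OF p] root[OF p] by (metis strict_mono_less)
    from order_tendstoD(1)[OF lim this] inS
    show "\<forall>\<^sub>F x in at p within S. r x < a"
      by eventually_elim (metis mono root strict_mono_less)
  qed
qed

section \<open>Reflection\<close>

text \<open>The action on states of the reflection \<open>x \<mapsto> -x\<close>.  It exchanges the two wave families and the
order of the two states, so that everything about 2-waves on the right of the weir follows from
1-waves on its left.\<close>

definition mirror :: "state \<Rightarrow> state" where
  "mirror w = (fst w, - snd w)"

lemma mirror_simps [simp]:
  "fst (mirror w) = fst w" "snd (mirror w) = - snd w" "mirror (mirror w) = w"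
  "mirror w \<in> subsonic g \<longleftrightarrow> w \<in> subsonic g"
  "lam1 g (mirror w) = - lam2 g w" "lam2 g (mirror w) = - lam1 g w"
  by (auto simp: mirror_def subsonic_def lam1.simps lam2.simps split: prod.splits)
     (cases w; simp)+

lemma continuous_on_mirror [continuous_intros]:
  "continuous_on S f \<Longrightarrow> continuous_on S (\<lambda>x. mirror (f x))"
  unfolding mirror_def by (intro continuous_intros)

lemma tendsto_mirror: "(f \<longlongrightarrow> a) F \<Longrightarrow> ((\<lambda>x. mirror (f x)) \<longlongrightarrow> mirror a) F"
  unfolding mirror_def by (intro tendsto_intros)

lemma joined2_mirror: "joined2 g a b \<longleftrightarrow> joined1 g (mirror b) (mirror a)"
proof (cases a, cases b)
  fix h v k w assume "a = (h, v)" "b = (k, w)"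
  then show ?thesis
    by (auto simp: mirror_def L1_def L2_def add.commute mult.commute algebra_simps)
qed

lemma shock_speed_mirror: "shock_speed (mirror b) (mirror a) = - shock_speed a b"
proof (cases a, cases b)
  fix h v k w assume "a = (h, v)" "b = (k, w)"
  then show ?thesis
    using minus_divide_right[of "k * w - h * v" "k - h"] by (simp add: mirror_def)
qed

section \<open>Discharge along the curve of 1-waves\<close>

definition flux1 :: "real \<Rightarrow> state \<Rightarrow> real \<Rightarrow> real" where
  "flux1 g w h = h * L1 g h (fst w) (snd w)"

text \<open>The critical state on the 1-rarefaction curve of \<open>w\<close>: there \<open>v + 2 \<surd>(g h)\<close> keeps its value and
\<open>v = \<surd>(g h)\<close>, so both are a third of \<open>v\<^sub>0 + 2 \<surd>(g h\<^sub>0)\<close>.\<close>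

definition sonic_speed :: "real \<Rightarrow> state \<Rightarrow> real" where
  "sonic_speed g w = (snd w + 2 * sqrt (g * fst w)) / 3"

definition sonic_height :: "real \<Rightarrow> state \<Rightarrow> real" where
  "sonic_height g w = (sonic_speed g w)\<^sup>2 / g"

text \<open>The 1-shock from a state of height \<open>h0\<close> and velocity \<open>v0\<close> to height \<open>h\<close> has speed
\<open>v0 - shock_factor g h0 h\<close>.\<close>

definition shock_factor :: "real \<Rightarrow> real \<Rightarrow> real \<Rightarrow> real" where
  "shock_factor g h0 h = sqrt (g * (h * (h + h0) / (2 * h0)))"

text \<open>The decreasing branch of the discharge, continued below the critical height by a line of slope
\<open>-1\<close>.  This makes it a decreasing bijection of the real line for every subsonic \<open>w\<close>, so that
its inverse has a domain independent of the parameter \<open>w\<close>; only the branch above the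
critical height has a physical meaning.\<close>

definition ext_flux :: "real \<Rightarrow> state \<Rightarrow> real \<Rightarrow> real" where
  "ext_flux g w h = flux1 g w (max h (sonic_height g w)) + (max h (sonic_height g w) - h)"

definition height_of_flux :: "real \<Rightarrow> state \<Rightarrow> real \<Rightarrow> real" where
  "height_of_flux g w q = (THE h. ext_flux g w h = q)"

context
  fixes g :: real
  assumes g: "g > 0"
begin

lemma subsonic_iff: "w \<in> subsonic g \<longleftrightarrow> fst w > 0 \<and> \<bar>snd w\<bar> < sqrt (g * fst w)"
  by (cases w) (simp add: subsonic_def)

lemma sonic_speed_bounds:
  assumes "w \<in> subsonic g"
  shows "0 < sonic_speed g w" "sonic_speed g w < sqrt (g * fst w)"
  using assms by (auto simp: subsonic_iff sonic_speed_def)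

lemma sqrt_sonic_height:
  assumes "w \<in> subsonic g"
  shows "sqrt (g * sonic_height g w) = sonic_speed g w"
  using sonic_speed_bounds[OF assms] g by (simp add: sonic_height_def)

lemma sonic_height_bounds:
  assumes "w \<in> subsonic g"
  shows "0 < sonic_height g w" "sonic_height g w < fst w"
proof -
  show "0 < sonic_height g w"
    using sonic_speed_bounds[OF assms] g by (simp add: sonic_height_def)
  have "sqrt (g * sonic_height g w) < sqrt (g * fst w)"
    using sonic_speed_bounds[OF assms] sqrt_sonic_height[OF assms] by simp
  then show "sonic_height g w < fst w" using g by simp
qed

text \<open>In this form, comparing \<open>h\<close> with the critical height is comparing \<open>\<surd>(g h)\<close> with the critical speed.\<close>

lemma L1_rarefaction:
  assumes "h \<le> fst w"
  shows "L1 g h (fst w) (snd w) = 3 * sonic_speed g w - 2 * sqrt (g * h)"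
  using assms by (simp add: L1_def sonic_speed_def field_simps)

lemma L1_self [simp]: "L1 g h h v = v" by (simp add: L1_def)

lemma L1_shock:
  assumes "h0 \<le> h"
  shows "L1 g h h0 v0 = v0 - (h - h0) * sqrt (1/2 * g * ((h + h0) / (h * h0)))"
  using assms by (auto simp: L1_def)

text \<open>On the shock branch, the square of the decrement \<open>v\<^sub>0 - v\<close> is, up to the factor \<open>g / 2\<close>,
\<open>(h - h\<^sub>0) (1 - h\<^sub>0/h) (h + h\<^sub>0)/h\<^sub>0\<close>, a product of nonnegative increasing factors.\<close>

lemma L1_strict_decreasing:
  assumes h0: "h0 > 0" and h: "0 < h" and hh: "h < h'"
  shows "L1 g h' h0 v0 < L1 g h h0 v0"
proof -
  have rare: "L1 g b h0 v0 < L1 g a h0 v0" if "0 < a" "a < b" "b \<le> h0" for a b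
    using that g by (simp add: L1_def)
  have shock: "L1 g b h0 v0 < L1 g a h0 v0" if ab: "h0 \<le> a" "a < b" for a b
  proof -
    have sq: "(x - h0) * sqrt (1/2 * g * ((x + h0) / (x * h0)))
         = sqrt (1/2 * g * ((x - h0) * (1 - h0 / x) * ((x + h0) / h0)))" if "h0 \<le> x" for x
    proof -
      have "(x - h0)\<^sup>2 * (1/2 * g * ((x + h0) / (x * h0)))
         = 1/2 * g * ((x - h0) * (1 - h0 / x) * ((x + h0) / h0))"
        using that h0 by (simp add: field_simps power2_eq_square)
      moreover have "(x - h0) * sqrt (1/2 * g * ((x + h0) / (x * h0)))
        = sqrt ((x - h0)\<^sup>2 * (1/2 * g * ((x + h0) / (x * h0))))"
        using that by (subst real_sqrt_mult) simp
      ultimately show ?thesis by simp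
    qed
    have "(a - h0) * (1 - h0 / a) \<le> (b - h0) * (1 - h0 / b)"
      using ab h0 by (intro mult_mono) (auto simp: frac_le)
    moreover have "0 < (b - h0) * (1 - h0 / b)" using ab h0 by simp
    moreover have "(a + h0) / h0 < (b + h0) / h0"
      using ab h0 by (simp add: divide_strict_right_mono)
    ultimately have "(a - h0) * (1 - h0 / a) * ((a + h0) / h0)
         < (b - h0) * (1 - h0 / b) * ((b + h0) / h0)"
      using ab h0 by (intro order.strict_trans1[OF mult_right_mono mult_strict_left_mono]) auto
    then have "1/2 * g * ((a - h0) * (1 - h0 / a) * ((a + h0) / h0))
         < 1/2 * g * ((b - h0) * (1 - h0 / b) * ((b + h0) / h0))"
      using g by (intro mult_strict_left_mono) auto
    then have "(a - h0) * sqrt (1/2 * g * ((a + h0) / (a * h0)))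
         < (b - h0) * sqrt (1/2 * g * ((b + h0) / (b * h0)))"
      using ab unfolding sq[OF ab(1)] sq[OF order.trans[OF ab(1) less_imp_le[OF ab(2)]]]
      by (rule_tac real_sqrt_less_mono)
    then show ?thesis
      using ab by (simp only: L1_shock)
  qed
  consider "h' \<le> h0" | "h0 \<le> h" | "h < h0" "h0 < h'" by linarith
  then show ?thesis
  proof cases
    case 3 show ?thesis using rare[OF h 3(1)] shock[OF _ 3(2)] by simp
  qed (use rare shock h hh in auto)
qed

lemma shock_factor_mono:
  assumes "0 < h0" "h0 \<le> h" "h \<le> h'"
  shows "shock_factor g h0 h \<le> shock_factor g h0 h'"
proof -
  have "h * (h + h0) \<le> h' * (h' + h0)" using assms by (intro mult_mono) auto
  then show ?thesis
    using assms g by (simp add: shock_factor_def divide_right_mono)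
qed

lemma shock_factor_self: "0 < h0 \<Longrightarrow> shock_factor g h0 h0 = sqrt (g * h0)"
  by (simp add: shock_factor_def)

lemma flux1_shock:
  assumes "0 < fst w" "fst w \<le> h"
  shows "flux1 g w h = fst w * snd w + (h - fst w) * (snd w - shock_factor g (fst w) h)"
proof -
  have "h * sqrt (1/2 * g * ((h + fst w) / (h * fst w)))
      = sqrt (h\<^sup>2 * (1/2 * g * ((h + fst w) / (h * fst w))))"
    using assms by (subst real_sqrt_mult) simp
  also have "h\<^sup>2 * (1/2 * g * ((h + fst w) / (h * fst w))) = g * (h * (h + fst w) / (2 * fst w))"
    using assms by (simp add: field_simps power2_eq_square)
  finally have "h * sqrt (1/2 * g * ((h + fst w) / (h * fst w))) = shock_factor g (fst w) h"
    by (simp add: shock_factor_def)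
  then show ?thesis
    using assms by (simp add: flux1_def L1_shock algebra_simps)
qed

lemma flux1_at_sonic_height:
  assumes "w \<in> subsonic g"
  shows "flux1 g w (sonic_height g w) = sonic_height g w * sonic_speed g w"
  using sonic_height_bounds[OF assms] sqrt_sonic_height[OF assms]
  by (simp add: flux1_def L1_rarefaction)

text \<open>The derivative of the discharge along a rarefaction is \<open>\<lambda>\<^sub>1\<close>, which is negative above the critical
height; along shocks the discharge is a fixed number plus \<open>h - h\<^sub>0\<close> times the shock speed, which is
negative and decreasing.  For the rarefaction the difference of two values is factored
explicitly, with \<open>s = \<surd>(g h)\<close> as variable: there \<open>g h v = s\<^sup>2 (3 c - 2 s)\<close> with \<open>c\<close> the critical speed.\<close>

lemma flux1_strict_decreasing:
  assumes w: "w \<in> subsonic g" and h: "sonic_height g w \<le> h" and hh: "h < h'"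
  shows "flux1 g w h' < flux1 g w h"
proof -
  have h0: "0 < fst w" using w by (simp add: subsonic_iff)
  have rare: "flux1 g w b < flux1 g w a"
    if ab: "sonic_height g w \<le> a" "a < b" "b \<le> fst w" for a b
  proof -
    define c s t where "c = sonic_speed g w" and "s = sqrt (g * a)" and "t = sqrt (g * b)"
    have c: "0 < c" using sonic_speed_bounds[OF w] by (simp add: c_def)
    have a0: "0 < a" using ab sonic_height_bounds[OF w] by simp
    have "sqrt (g * sonic_height g w) \<le> s" using ab g by (simp add: s_def)
    then have cs: "c \<le> s" by (simp add: sqrt_sonic_height[OF w] c_def)
    have st: "s < t" using ab g by (simp add: s_def t_def)
    have sq: "s\<^sup>2 = g * a" "t\<^sup>2 = g * b" using a0 ab g by (auto simp: s_def t_def)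
    \<comment> \<open>The second factor rewrites \<open>2 (s\<^sup>2 + s t + t\<^sup>2) - 3 c (s + t)\<close> so that \<open>c \<le> s < t\<close> gives its sign.\<close>
    have "0 < (t - s) * ((2 * t + s) * (t - s) + 3 * ((s - c) * (s + t)))"
      using c cs st by (intro mult_pos_pos add_pos_nonneg) auto
    also have "\<dots> = s\<^sup>2 * (3 * c - 2 * s) - t\<^sup>2 * (3 * c - 2 * t)"
      by (simp add: algebra_simps power2_eq_square)
    also have "\<dots> = g * (flux1 g w a - flux1 g w b)"
      using ab by (simp add: sq flux1_def L1_rarefaction flip: c_def s_def t_def)
         (simp add: algebra_simps)
    finally show ?thesis using g by (simp add: zero_less_mult_iff)
  qed
  have shock: "flux1 g w b < flux1 g w a" if ab: "fst w \<le> a" "a < b" for a b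
  proof -
    have "snd w < sqrt (g * fst w)" using w by (auto simp: subsonic_iff)
    also have "\<dots> \<le> shock_factor g (fst w) a"
      using shock_factor_mono[OF h0 _ ab(1)] by (simp add: shock_factor_self h0)
    finally have 1: "0 < shock_factor g (fst w) a - snd w" by simp
    have 2: "shock_factor g (fst w) a \<le> shock_factor g (fst w) b"
      using shock_factor_mono h0 ab by simp
    have "(a - fst w) * (shock_factor g (fst w) a - snd w)
        < (b - fst w) * (shock_factor g (fst w) b - snd w)"
      using 1 2 ab by (intro mult_less_le_imp_less) auto
    then show ?thesis using ab h0 by (simp add: flux1_shock algebra_simps)
  qed
  consider "h' \<le> fst w" | "fst w \<le> h" | "h < fst w" "fst w < h'" by linarith
  then show ?thesis
  proof cases
    case 3 show ?thesis using rare[OF h 3(1)] shock[OF _ 3(2)] by simp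
  qed (use rare shock h hh in auto)
qed

text \<open>A linear bound with negative slope is what makes the discharge reach every negative value.\<close>

lemma flux1_le_linear:
  assumes w: "w \<in> subsonic g" and h: "fst w \<le> h"
  shows "flux1 g w h \<le> fst w * snd w - (h - fst w) * (sqrt (g * fst w) - snd w)"
proof -
  have h0: "0 < fst w" using w by (simp add: subsonic_iff)
  have "sqrt (g * fst w) \<le> shock_factor g (fst w) h"
    using shock_factor_mono[OF h0 _ h] by (simp add: shock_factor_self h0)
  then have "(h - fst w) * (sqrt (g * fst w) - snd w) \<le> (h - fst w) * (shock_factor g (fst w) h - snd w)"
    using h by (intro mult_left_mono) auto
  then show ?thesis using h h0 by (simp add: flux1_shock algebra_simps)
qed

lemma continuous_on_sonic_height:
  "continuous_on S f \<Longrightarrow> continuous_on S (\<lambda>x. sonic_height g (f x))"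
  unfolding sonic_height_def sonic_speed_def using g by (intro continuous_intros) auto

lemma continuous_on_L1:
  assumes f: "continuous_on S f" and k: "continuous_on S k"
    and pos: "\<And>x. x \<in> S \<Longrightarrow> 0 < fst (f x)" "\<And>x. x \<in> S \<Longrightarrow> 0 < k x"
  shows "continuous_on S (\<lambda>x. L1 g (k x) (fst (f x)) (snd (f x)))"
proof -
  \<comment> \<open>Since each branch vanishes where the other one is active, the case distinction disappears.\<close>
  have eq: "L1 g h h0 v0 = v0 - 2 * (sqrt (g * min h h0) - sqrt (g * h0))
      - (max h h0 - h0) * sqrt (1/2 * g * ((max h h0 + h0) / (max h h0 * h0)))"
    for h h0 v0
    by (auto simp: L1_def min_def max_def)
  have "fst (f x) \<noteq> 0 \<and> max (k x) (fst (f x)) \<noteq> 0" if "x \<in> S" for x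
    using pos[OF that] by (auto simp: max_def)
  then show ?thesis
    unfolding eq by (intro continuous_intros f k) auto
qed

lemma continuous_on_ext_flux:
  assumes f: "continuous_on S f" and k: "continuous_on S k"
    and sub: "\<And>x. x \<in> S \<Longrightarrow> f x \<in> subsonic g"
  shows "continuous_on S (\<lambda>x. ext_flux g (f x) (k x))"
proof -
  have "0 < fst (f x) \<and> 0 < max (k x) (sonic_height g (f x))" if "x \<in> S" for x
    using sub[OF that] sonic_height_bounds[OF sub[OF that]] by auto
  then show ?thesis
    unfolding ext_flux_def flux1_def
    by (intro continuous_intros continuous_on_L1 continuous_on_sonic_height f k) auto
qed

lemma ext_flux_eq_flux1: "sonic_height g w \<le> h \<Longrightarrow> ext_flux g w h = flux1 g w h"
  by (simp add: ext_flux_def max_def)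

lemma ext_flux_strict_decreasing:
  assumes w: "w \<in> subsonic g" and hh: "h < h'"
  shows "ext_flux g w h' < ext_flux g w h"
  using flux1_strict_decreasing[OF w, of "max h (sonic_height g w)" "max h' (sonic_height g w)"] hh
  by (auto simp: ext_flux_def max_def split: if_splits)

lemma ext_flux_surj:
  assumes w: "w \<in> subsonic g"
  obtains h where "ext_flux g w h = q"
proof -
  define d where "d = sqrt (g * fst w) - snd w"
  have d: "0 < d" using w by (auto simp: d_def subsonic_iff)
  let ?s = "sonic_height g w"
  define a where "a = ?s - \<bar>q - flux1 g w ?s\<bar>"
  define b where "b = fst w + \<bar>fst w * snd w - q\<bar> / d"
  have "q \<le> ext_flux g w a" by (simp add: ext_flux_def a_def max_def)
  moreover have "ext_flux g w b \<le> q"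
  proof -
    have b: "fst w \<le> b" using d by (simp add: b_def)
    then have "ext_flux g w b = flux1 g w b"
      using sonic_height_bounds[OF w] by (simp add: ext_flux_eq_flux1)
    also have "\<dots> \<le> fst w * snd w - (b - fst w) * d"
      unfolding d_def by (rule flux1_le_linear[OF w b])
    also have "(b - fst w) * d = \<bar>fst w * snd w - q\<bar>" using d by (simp add: b_def)
    finally show ?thesis by linarith
  qed
  moreover have "a \<le> b"
    using sonic_height_bounds[OF w] d by (auto simp: a_def b_def intro: order_trans[of _ "fst w"])
  moreover have "continuous_on {a..b} (ext_flux g w)"
    by (intro continuous_on_ext_flux continuous_intros w)
  ultimately show ?thesis
    using IVT2'[of "ext_flux g w" b q a] that by blast
qed

lemma height_of_flux_eq_iff:
  assumes w: "w \<in> subsonic g"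
  shows "height_of_flux g w q = h \<longleftrightarrow> ext_flux g w h = q"
proof -
  have ex1: "\<exists>!h. ext_flux g w h = q"
  proof (rule ex_ex1I)
    show "\<exists>h. ext_flux g w h = q" using ext_flux_surj[OF w] by metis
    show "h = k" if "ext_flux g w h = q" "ext_flux g w k = q" for h k
      using that ext_flux_strict_decreasing[OF w, of h k] ext_flux_strict_decreasing[OF w, of k h]
      by linarith
  qed
  show ?thesis
    unfolding height_of_flux_def using theI'[OF ex1] the1_equality[OF ex1] by blast
qed

lemma height_of_flux_strict_decreasing:
  assumes w: "w \<in> subsonic g" and "q < q'"
  shows "height_of_flux g w q' < height_of_flux g w q"
proof (rule ccontr)
  let ?h = "height_of_flux g w"
  assume "\<not> ?h q' < ?h q"
  then have "ext_flux g w (?h q') \<le> ext_flux g w (?h q)"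
    using ext_flux_strict_decreasing[OF w, of "?h q" "?h q'"] by (cases "?h q = ?h q'") auto
  moreover have "ext_flux g w (?h r) = r" for r
    using height_of_flux_eq_iff[OF w] by blast
  ultimately show False using assms by simp
qed

lemma continuous_on_height_of_flux:
  assumes f: "continuous_on S f" and k: "continuous_on S k"
    and sub: "\<And>x. x \<in> S \<Longrightarrow> f x \<in> subsonic g"
  shows "continuous_on S (\<lambda>x. height_of_flux g (f x) (k x))"
proof (rule continuous_on_root[where F = "\<lambda>x h. k x - ext_flux g (f x) h"])
  show "continuous_on S (\<lambda>x. k x - ext_flux g (f x) y)" for y
    by (intro continuous_intros continuous_on_ext_flux f k sub)
  show "strict_mono (\<lambda>h. k x - ext_flux g (f x) h)" if "x \<in> S" for x
    using ext_flux_strict_decreasing[OF sub[OF that]] by (simp add: strict_mono_def)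
  show "k x - ext_flux g (f x) (height_of_flux g (f x) (k x)) = 0" if "x \<in> S" for x
    using height_of_flux_eq_iff[OF sub[OF that]] by (metis diff_self)
qed


section \<open>Waves and their limits at the weir\<close>

definition profile :: "state \<Rightarrow> state \<Rightarrow> state \<Rightarrow> real \<Rightarrow> state" where
  "profile a b m \<xi> = (if \<xi> < snd m then wave1 g a m \<xi> else wave2 g m b \<xi>)"

lemma lax_solution_iff_profile:
  "lax_solution g a b U \<longleftrightarrow>
     (\<exists>m. fst m > 0 \<and> joined1 g a m \<and> joined2 g m b \<and>
        (\<forall>x. U 0 x = (if x < 0 then a else b)) \<and> (\<forall>t>0. \<forall>x. U t x = profile a b m (x / t)))"
  by (simp add: lax_solution_def profile_def)

lemma joined1_iff: "joined1 g a m \<longleftrightarrow> snd m = L1 g (fst m) (fst a) (snd a)"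
  by (cases a; cases m) simp

lemma joined1_refl: "joined1 g a a"
  by (simp add: joined1_iff)

lemma joined2_refl: "joined2 g a a"
  by (simp add: joined2_mirror joined1_refl)

text \<open>The velocity of the middle state decreases with its height along the 1-curve of \<open>a\<close>, and increases
along the mirrored 1-curve of \<open>b\<close>, so these curves meet at most once.\<close>

lemma middle_state_unique:
  assumes "fst a > 0" "fst b > 0" "fst m > 0" "fst n > 0"
    and "joined1 g a m" "joined2 g m b" "joined1 g a n" "joined2 g n b"
  shows "m = n"
proof -
  have no: False if "fst m < fst n" "fst m > 0"
    "joined1 g a m" "joined2 g m b" "joined1 g a n" "joined2 g n b" for m n
    using that assms(1,2) L1_strict_decreasing[of "fst a" "fst m" "fst n" "snd a"]
      L1_strict_decreasing[of "fst b" "fst m" "fst n" "- snd b"]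
    by (simp add: joined1_iff joined2_mirror)
  have "fst m = fst n"
    using no[of m n] no[of n m] assms by (cases "fst m" "fst n" rule: linorder_cases) auto
  then show ?thesis
    using assms(5,7) by (simp add: joined1_iff prod_eq_iff)
qed

lemma lam1_eq: "lam1 g w = snd w - sqrt (g * fst w)"
  by (cases w) simp

lemma lam2_eq: "lam2 g w = snd w + sqrt (g * fst w)"
  by (cases w) simp

lemma lam1_rarefaction:
  assumes "joined1 g a m" "fst m \<le> fst a"
  shows "lam1 g m = 3 * (sonic_speed g a - sqrt (g * fst m))"
  using assms by (simp add: joined1_iff lam1_eq L1_rarefaction)

text \<open>This identifies the decreasing branch of the discharge with the rarefactions that stay on the
left of the weir.\<close>

lemma lam1_sign_iff:
  assumes a: "a \<in> subsonic g" and "joined1 g a m" "fst m \<le> fst a"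
  shows "lam1 g m < 0 \<longleftrightarrow> sonic_height g a < fst m" "lam1 g m = 0 \<longleftrightarrow> sonic_height g a = fst m"
proof -
  have "lam1 g m = 3 * (sqrt (g * sonic_height g a) - sqrt (g * fst m))"
    using assms lam1_rarefaction sqrt_sonic_height by simp
  then show "lam1 g m < 0 \<longleftrightarrow> sonic_height g a < fst m" "lam1 g m = 0 \<longleftrightarrow> sonic_height g a = fst m"
    using g by auto
qed

text \<open>By the Lax inequality the speed lies below \<open>\<lambda>\<^sub>1\<close> of the left state, which is negative for subsonic data.\<close>

lemma shock_speed_neg:
  assumes a: "a \<in> subsonic g" and j: "joined1 g a m" and h: "fst a < fst m"
  shows "shock_speed a m < 0"
proof -
  have h0: "0 < fst a" using a by (simp add: subsonic_iff)
  have "shock_speed a m = (fst m * snd m - fst a * snd a) / (fst m - fst a)"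
    by (cases a; cases m) simp
  also have "fst m * snd m = flux1 g a (fst m)"
    using j by (simp add: joined1_iff flux1_def)
  also have "\<dots> - fst a * snd a = (fst m - fst a) * (snd a - shock_factor g (fst a) (fst m))"
    using h h0 by (simp add: flux1_shock)
  also have "\<dots> / (fst m - fst a) = snd a - shock_factor g (fst a) (fst m)"
    using h by simp
  also have "\<dots> < 0"
  proof -
    have "snd a < sqrt (g * fst a)" using a by (auto simp: subsonic_iff)
    also have "\<dots> \<le> shock_factor g (fst a) (fst m)"
      using shock_factor_mono[OF h0 order.refl, of "fst m"] h by (simp add: shock_factor_self[OF h0])
    finally show ?thesis by simp
  qed
  finally show ?thesis .
qed

lemma fan1_zero: "fan1 g a 0 = (sonic_height g a, sonic_speed g a)"
  by (cases a) (simp add: sonic_height_def sonic_speed_def Let_def)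

lemma isCont_fan1: "isCont (fan1 g a) x"
proof -
  have "fan1 g a = (\<lambda>\<xi>. (((snd a + 2 * sqrt (g * fst a) - \<xi>) / 3)\<^sup>2 / g, \<xi> + (snd a + 2 * sqrt (g * fst a) - \<xi>) / 3))"
    by (cases a) (auto simp: Let_def)
  then show ?thesis using g by (auto intro!: continuous_intros)
qed

lemma isCont_fan2: "isCont (fan2 g a) x"
proof -
  have "fan2 g a = (\<lambda>\<xi>. (((\<xi> - snd a + 2 * sqrt (g * fst a)) / 3)\<^sup>2 / g, \<xi> - (\<xi> - snd a + 2 * sqrt (g * fst a)) / 3))"
    by (cases a) (auto simp: Let_def)
  then show ?thesis using g by (auto intro!: continuous_intros)
qed

lemma critical_not_subsonic: "(c\<^sup>2 / g, c) \<notin> subsonic g" "(c\<^sup>2 / g, - c) \<notin> subsonic g"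
  using g by (auto simp: subsonic_iff)

text \<open>Beyond the critical height the whole wave lies to the left of \<open>x = 0\<close>.  Below it, a
transonic rarefaction straddles the weir and its critical state is seen instead.\<close>

lemma wave1_left_limit:
  assumes a: "a \<in> subsonic g" and j: "joined1 g a m"
  shows "(wave1 g a m \<longlongrightarrow>
           (if sonic_height g a \<le> fst m then m else (sonic_height g a, sonic_speed g a))) (at_left 0)"
    (is "(_ \<longlongrightarrow> ?l) _")
proof (cases "fst m \<le> fst a")
  case True
  have la: "lam1 g a < 0" using a by (auto simp: subsonic_iff lam1_eq)
  note neg = lam1_sign_iff[OF a j True]
  show ?thesis
  proof (cases "lam1 g m < 0")
    case m: True
    have "\<forall>\<^sub>F \<xi> in at_left 0. wave1 g a m \<xi> = m"
      using eventually_at_left_real[OF m] eventually_at_left_real[OF la]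
      by eventually_elim (use True in \<open>auto simp: wave1_def\<close>)
    then show ?thesis
      using neg m by (simp add: tendsto_eventually)
  next
    case False
    have "\<forall>\<^sub>F \<xi> in at_left 0. fan1 g a \<xi> = wave1 g a m \<xi>"
      using eventually_at_left_real[OF la]
      by eventually_elim (use True False in \<open>auto simp: wave1_def\<close>)
    moreover have "(fan1 g a \<longlongrightarrow> fan1 g a 0) (at_left 0)"
      using isCont_fan1[where a = a and x = 0] unfolding isCont_def by (rule tendsto_within_subset) simp
    ultimately have lim: "(wave1 g a m \<longlongrightarrow> fan1 g a 0) (at_left 0)"
      by (rule Lim_transform_eventually[rotated])
    have "?l = fan1 g a 0"
    proof (cases "lam1 g m = 0")
      case 0: True
      then have "snd m = sqrt (g * fst m)" "fst m = sonic_height g a"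
        using neg by (auto simp: lam1_eq)
      then show ?thesis
        using sqrt_sonic_height[OF a] by (simp add: fan1_zero prod_eq_iff)
    next
      case 0: False
      then show ?thesis using neg False by (auto simp: fan1_zero)
    qed
    then show ?thesis using lim by simp
  qed
next
  case False
  have "\<forall>\<^sub>F \<xi> in at_left 0. wave1 g a m \<xi> = m"
    by (rule eventually_mono[OF eventually_at_left_real[OF shock_speed_neg[OF a j]]])
       (use False in \<open>auto simp: wave1_def\<close>)
  moreover have "sonic_height g a \<le> fst m"
    using sonic_height_bounds[OF a] False by simp
  ultimately show ?thesis by (simp add: tendsto_eventually)
qed

text \<open>A 2-wave with subsonic right state has \<open>\<lambda>\<^sub>2 > 0\<close> there, and a shock is even faster; hence the wave is
either entirely to the right of \<open>x = 0\<close> or a transonic fan that shows its critical state.\<close>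

lemma wave2_left_limit:
  assumes b: "b \<in> subsonic g" and j: "joined2 g m b"
  obtains l where "(wave2 g m b \<longlongrightarrow> l) (at_left 0)" "l = m \<or> l \<notin> subsonic g"
proof (cases "fst m \<le> fst b")
  case True
  have lb: "lam2 g b > 0" using b by (auto simp: subsonic_iff lam2_eq)
  show ?thesis
  proof (cases "lam2 g m < 0")
    case m: True
    have "\<forall>\<^sub>F \<xi> in at_left 0. fan2 g m \<xi> = wave2 g m b \<xi>"
      using eventually_at_left_real[OF m]
      by eventually_elim (use True lb in \<open>auto simp: wave2_def\<close>)
    moreover have "(fan2 g m \<longlongrightarrow> fan2 g m 0) (at_left 0)"
      using isCont_fan2[where a = m and x = 0] unfolding isCont_def by (rule tendsto_within_subset) simp
    ultimately have "(wave2 g m b \<longlongrightarrow> fan2 g m 0) (at_left 0)"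
      by (rule Lim_transform_eventually[rotated])
    moreover have "fan2 g m 0 \<notin> subsonic g"
      by (cases m) (simp only: fan2.simps Let_def diff_0 critical_not_subsonic, simp)
    ultimately show ?thesis using that by blast
  next
    case False
    have "\<forall>\<^sub>F \<xi> in at_left 0. wave2 g m b \<xi> = m"
      by (intro eventually_mono[OF eventually_at_left_real[of "-1" "0::real"]])
         (use True False in \<open>auto simp: wave2_def\<close>)
    then show ?thesis using that[of m] by (simp add: tendsto_eventually)
  qed
next
  case False
  have "shock_speed (mirror b) (mirror m) < 0"
    using False b j by (intro shock_speed_neg) (auto simp: joined2_mirror)
  then have "shock_speed m b > 0" by (simp add: shock_speed_mirror)
  then have "\<forall>\<^sub>F \<xi> in at_left 0. wave2 g m b \<xi> = m"
    by (intro eventually_mono[OF eventually_at_left_real[of "-1" "0::real"]])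
       (use False in \<open>auto simp: wave2_def\<close>)
  then show ?thesis using that[of m] by (simp add: tendsto_eventually)
qed

text \<open>This is where the selection of solutions enters.  The profile is cut at the middle velocity, so
the sign of \<open>snd m\<close> decides which of the two waves is seen from \<open>x = 0-\<close>.  If it is the 2-wave,
then \<open>snd m < 0\<close>, and as the velocity decreases along the 1-curve and is positive at the critical
height, \<open>m\<close> is above that height.  If it is the 1-wave, the trace is \<open>m\<close> or critical, and the latter is
excluded for subsonic traces as well as for glued ones, for which \<open>m = b\<close>.\<close>

lemma left_trace_admissible:
  assumes a: "a \<in> subsonic g" and pos: "fst m > 0" "fst b > 0"
    and j: "joined1 g a m" "joined2 g m b"
    and lim: "(profile a b m \<longlongrightarrow> b) (at_left 0)"
    and b: "joined1 g a b \<or> b \<in> subsonic g"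
  shows "joined1 g a b \<and> sonic_height g a \<le> fst b"
proof -
  have a0: "fst a > 0" using a by (simp add: subsonic_iff)
  have glued: "m = b" if "joined1 g a b"
    using middle_state_unique[OF a0 pos(2) pos j that joined2_refl] .
  show ?thesis
  proof (cases "snd m < 0")
    case True
    have "sonic_height g a < fst m"
    proof (rule ccontr)
      assume "\<not> ?thesis"
      then have "fst m \<le> sonic_height g a" by simp
      then have "L1 g (sonic_height g a) (fst a) (snd a) \<le> snd m"
        using j(1) L1_strict_decreasing[OF a0 pos(1), of "sonic_height g a" "snd a"]
        by (cases "fst m = sonic_height g a") (auto simp: joined1_iff)
      moreover have "L1 g (sonic_height g a) (fst a) (snd a) = sonic_speed g a"
        using sonic_height_bounds[OF a] sqrt_sonic_height[OF a] by (simp add: L1_rarefaction)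
      ultimately show False using True sonic_speed_bounds[OF a] by simp
    qed
    moreover have "m = b"
    proof (cases "joined1 g a b")
      case False
      then have sub: "b \<in> subsonic g" using b by simp
      obtain l where l: "(wave2 g m b \<longlongrightarrow> l) (at_left 0)" "l = m \<or> l \<notin> subsonic g"
        using wave2_left_limit[OF sub j(2)] .
      have "\<forall>\<^sub>F \<xi> in at_left 0. wave2 g m b \<xi> = profile a b m \<xi>"
        using eventually_at_left_real[OF True] by eventually_elim (auto simp: profile_def)
      then have "(profile a b m \<longlongrightarrow> l) (at_left 0)"
        by (rule Lim_transform_eventually[OF l(1)])
      then have "l = b" using lim by (rule tendsto_unique[rotated]) simp
      then show ?thesis using l(2) sub by auto
    qed (rule glued)
    ultimately show ?thesis using j(1) by auto
  next
    case False
    have "\<forall>\<^sub>F \<xi> in at_left 0. wave1 g a m \<xi> = profile a b m \<xi>"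
      by (intro eventually_mono[OF eventually_at_left_real[of "-1" "0::real"]])
         (use False in \<open>auto simp: profile_def\<close>)
    then have "(profile a b m \<longlongrightarrow> (if sonic_height g a \<le> fst m then m
        else (sonic_height g a, sonic_speed g a))) (at_left 0)"
      by (rule Lim_transform_eventually[OF wave1_left_limit[OF a j(1)]])
    then have eq: "(if sonic_height g a \<le> fst m then m else (sonic_height g a, sonic_speed g a)) = b"
      using lim by (rule tendsto_unique[rotated]) simp
    show ?thesis
    proof (cases "sonic_height g a \<le> fst m")
      case True
      then show ?thesis using eq j by auto
    next
      case h: False
      then have beq: "b = (sonic_height g a, sonic_speed g a)" using eq by simp
      then have "b \<notin> subsonic g" using critical_not_subsonic by (simp add: sonic_height_def)
      then have "m = b" using b glued by auto
      then show ?thesis using h beq by auto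
    qed
  qed
qed

lemma profile_left_limit:
  assumes a: "a \<in> subsonic g" and j: "joined1 g a b" and h: "sonic_height g a \<le> fst b"
  shows "(profile a b b \<longlongrightarrow> b) (at_left 0)"
proof (cases "snd b < 0")
  case True
  have "\<forall>\<^sub>F \<xi> in at_left 0. profile a b b \<xi> = b"
    using eventually_at_left_real[OF True]
    by eventually_elim (auto simp: profile_def wave2_def)
  then show ?thesis by (rule tendsto_eventually)
next
  case False
  have "\<forall>\<^sub>F \<xi> in at_left 0. wave1 g a b \<xi> = profile a b b \<xi>"
    by (intro eventually_mono[OF eventually_at_left_real[of "-1" "0::real"]])
       (use False in \<open>auto simp: profile_def\<close>)
  then show ?thesis
    using wave1_left_limit[OF a j] h by (auto intro: Lim_transform_eventually)
qed

text \<open>Profiles are continuous from the right, which reflection does not preserve; the two sides can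
therefore differ at the jumps.  The exceptions are finitely many and so do not affect limits.\<close>

lemma wave2_mirror:
  assumes j: "joined2 g a b" and \<xi>: "\<xi> \<notin> {lam2 g a, lam2 g b, shock_speed a b}"
  shows "wave2 g a b \<xi> = mirror (wave1 g (mirror b) (mirror a) (- \<xi>))"
proof (cases "fst a \<le> fst b")
  case True
  have eq: "snd b - snd a = 2 * (sqrt (g * fst b) - sqrt (g * fst a))"
    using j True by (cases a; cases b) (simp add: L2_def)
  have le: "sqrt (g * fst a) \<le> sqrt (g * fst b)" using True g by simp
  have "u + s \<le> v + t" if "v - u = 2 * (t - s)" "s \<le> t" for s t u v :: real
    using that by (simp add: algebra_simps)
  from this[OF eq le] have "lam2 g a \<le> lam2 g b" unfolding lam2_eq .
  moreover have "fan2 g a \<xi> = mirror (fan1 g (mirror b) (- \<xi>))"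
  proof -
    define c where "c = (\<xi> - snd a + 2 * sqrt (g * fst a)) / 3"
    have c: "c = (- snd b + 2 * sqrt (g * fst b) - - \<xi>) / 3"
      using eq by (simp add: c_def)
    have "fan2 g a \<xi> = (c\<^sup>2 / g, \<xi> - c)"
      by (cases a) (simp add: c_def Let_def)
    moreover have "fan1 g (mirror b) (- \<xi>) = (c\<^sup>2 / g, - \<xi> + c)"
      by (cases b) (simp add: c mirror_def Let_def)
    ultimately show ?thesis by (simp add: mirror_def)
  qed
  ultimately show ?thesis using True \<xi> by (auto simp: wave1_def wave2_def)
next
  case False
  then show ?thesis using \<xi> by (auto simp: wave1_def wave2_def shock_speed_mirror)
qed

lemma profile_mirror:
  assumes "joined1 g a m" "joined2 g m b"
  shows "\<forall>\<^sub>F \<xi> in at x within S. profile (mirror b) (mirror a) (mirror m) (- \<xi>) = mirror (profile a b m \<xi>)"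
proof -
  have "\<forall>\<^sub>F \<xi> in at x within S. \<xi> \<notin>
      {snd m, lam2 g m, lam2 g b, shock_speed m b, lam1 g a, lam1 g m, shock_speed a m}"
    by (simp add: eventually_conj eventually_neq_at_within)
  then show ?thesis
  proof eventually_elim
    case (elim \<xi>)
    show ?case
    proof (cases "\<xi> < snd m")
      case True
      have "wave2 g (mirror m) (mirror a) (- \<xi>)
          = mirror (wave1 g (mirror (mirror a)) (mirror (mirror m)) (- (- \<xi>)))"
        using assms elim by (intro wave2_mirror) (auto simp: joined2_mirror shock_speed_mirror)
      then show ?thesis using True by (simp add: profile_def)
    next
      case False
      then show ?thesis
        using wave2_mirror[OF assms(2), of \<xi>] elim by (auto simp: profile_def)
    qed
  qed
qed

lemma right_limit_mirror:
  assumes "joined1 g a m" "joined2 g m b"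
  shows "(profile a b m \<longlongrightarrow> l) (at_right 0) \<longleftrightarrow>
    (profile (mirror b) (mirror a) (mirror m) \<longlongrightarrow> mirror l) (at_left 0)"
proof -
  have "(profile (mirror b) (mirror a) (mirror m) \<longlongrightarrow> mirror l) (at_left 0) \<longleftrightarrow>
    ((\<lambda>\<xi>. mirror (profile a b m \<xi>)) \<longlongrightarrow> mirror l) (at_right 0)"
    using tendsto_cong[OF profile_mirror[OF assms]]
    by (simp add: filterlim_at_left_to_right)
  also have "\<dots> \<longleftrightarrow> (profile a b m \<longlongrightarrow> l) (at_right 0)"
    using tendsto_mirror[of "\<lambda>\<xi>. mirror (profile a b m \<xi>)" "mirror l"] tendsto_mirror[of "profile a b m" l]
    by auto
  finally show ?thesis by simp
qed

lemma left_trace: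
  assumes a: "a \<in> subsonic g" and pos: "fst b > 0" and U: "lax_solution g a b U"
    and lim: "(U 1 \<longlongrightarrow> b) (at_left 0)" and b: "joined1 g a b \<or> b \<in> subsonic g"
  shows "joined1 g a b \<and> sonic_height g a \<le> fst b"
proof -
  obtain m where m: "fst m > 0" "joined1 g a m" "joined2 g m b" "\<forall>t>0. \<forall>x. U t x = profile a b m (x / t)"
    using U by (auto simp: lax_solution_iff_profile)
  have "U 1 = profile a b m" using m(4) by auto
  then show ?thesis using left_trace_admissible[OF a m(1) pos m(2,3) _ b] lim by simp
qed

lemma right_trace:
  assumes b: "b \<in> subsonic g" and pos: "fst a > 0" and U: "lax_solution g a b U"
    and lim: "(U 1 \<longlongrightarrow> a) (at_right 0)" and a: "joined2 g a b \<or> a \<in> subsonic g"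
  shows "joined2 g a b \<and> sonic_height g (mirror b) \<le> fst a"
proof -
  obtain m where m: "fst m > 0" "joined1 g a m" "joined2 g m b" "\<forall>t>0. \<forall>x. U t x = profile a b m (x / t)"
    using U by (auto simp: lax_solution_iff_profile)
  have "U 1 = profile a b m" using m(4) by auto
  then show ?thesis
    using left_trace_admissible[of "mirror b" "mirror m" "mirror a"] assms m
    by (simp add: right_limit_mirror joined2_mirror)
qed

lemma lax_solution_unique:
  assumes "fst a > 0" "fst b > 0" "lax_solution g a b U" "lax_solution g a b V" "t \<ge> 0"
  shows "U t x = V t x"
proof -
  obtain m n where "fst m > 0" "joined1 g a m" "joined2 g m b"
      "\<forall>x. U 0 x = (if x < 0 then a else b)" "\<forall>t>0. \<forall>x. U t x = profile a b m (x / t)"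
    and "fst n > 0" "joined1 g a n" "joined2 g n b"
      "\<forall>x. V 0 x = (if x < 0 then a else b)" "\<forall>t>0. \<forall>x. V t x = profile a b n (x / t)"
    using assms by (auto simp: lax_solution_iff_profile)
  moreover from this have "m = n" using assms middle_state_unique by blast
  ultimately show ?thesis using assms by (cases "t = 0") auto
qed

definition lax_function :: "state \<Rightarrow> state \<Rightarrow> state \<Rightarrow> real \<Rightarrow> real \<Rightarrow> state" where
  "lax_function a b m t x =
     (if t = 0 then if x < 0 then a else b else profile a b m (x / t))"

lemma lax_solution_lax_function:
  assumes "fst m > 0" "joined1 g a m" "joined2 g m b"
  shows "lax_solution g a b (lax_function a b m)"
  unfolding lax_solution_iff_profile using assms
  by (intro exI[of _ m]) (auto simp: lax_function_def)

lemma lax_function_left_limit: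
  assumes "(profile a b m \<longlongrightarrow> l) (at_left 0)" "t > 0"
  shows "(lax_function a b m t \<longlongrightarrow> l) (at_left 0)"
proof -
  have "filterlim (\<lambda>x. x / t) (at_left 0) (at_left 0)"
    unfolding filterlim_at using assms(2)
    by (auto intro!: tendsto_eq_intros simp: eventually_at_filter divide_less_0_iff)
  from filterlim_compose[OF assms(1) this] show ?thesis
    using assms(2) by (simp add: lax_function_def[abs_def])
qed

lemma lax_function_right_limit:
  assumes "(profile a b m \<longlongrightarrow> l) (at_right 0)" "t > 0"
  shows "(lax_function a b m t \<longlongrightarrow> l) (at_right 0)"
proof -
  have "filterlim (\<lambda>x. x / t) (at_right 0) (at_right 0)"
    unfolding filterlim_at using assms(2)
    by (auto intro!: tendsto_eq_intros simp: eventually_at_filter zero_less_divide_iff)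
  from filterlim_compose[OF assms(1) this] show ?thesis
    using assms(2) by (simp add: lax_function_def[abs_def])
qed


section \<open>The discharge through the weir\<close>

text \<open>The left trace that carries the discharge \<open>q\<close>.  The right trace for the right datum \<open>w\<close> is
\<open>mirror (left_state (mirror w) (-q))\<close>, as reflection changes the sign of the discharge.\<close>

definition left_state :: "state \<Rightarrow> real \<Rightarrow> state" where
  "left_state w q =
     (height_of_flux g w q, L1 g (height_of_flux g w q) (fst w) (snd w))"

text \<open>The largest discharge on the 1-wave curve of \<open>w\<close>, attained at the critical state.\<close>

definition sonic_flux :: "state \<Rightarrow> real" where
  "sonic_flux w = sonic_height g w * sonic_speed g w"

lemma sonic_flux_pos: "w \<in> subsonic g \<Longrightarrow> 0 < sonic_flux w"
  using sonic_height_bounds sonic_speed_bounds by (simp add: sonic_flux_def)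

lemma height_of_sonic_flux:
  assumes "w \<in> subsonic g"
  shows "height_of_flux g w (sonic_flux w) = sonic_height g w"
  unfolding height_of_flux_eq_iff[OF assms]
  using assms by (simp add: ext_flux_eq_flux1 flux1_at_sonic_height sonic_flux_def)

lemma left_state_of_flux:
  assumes w: "w \<in> subsonic g" and q: "q < sonic_flux w"
  shows "sonic_height g w < fst (left_state w q)"
    and "joined1 g w (left_state w q)"
    and "fst (left_state w q) * snd (left_state w q) = q"
proof -
  show s: "sonic_height g w < fst (left_state w q)"
    using height_of_flux_strict_decreasing[OF w q] height_of_sonic_flux[OF w]
    by (simp add: left_state_def)
  show "joined1 g w (left_state w q)"
    by (simp add: joined1_iff left_state_def)
  have "ext_flux g w (height_of_flux g w q) = q"
    using height_of_flux_eq_iff[OF w] by blast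
  then show "fst (left_state w q) * snd (left_state w q) = q"
    using s by (simp add: left_state_def ext_flux_eq_flux1 flux1_def)
qed

lemma left_state_eqI:
  assumes w: "w \<in> subsonic g" and "joined1 g w m" "sonic_height g w \<le> fst m"
  shows "m = left_state w (fst m * snd m)"
proof -
  have "height_of_flux g w (fst m * snd m) = fst m"
    unfolding height_of_flux_eq_iff[OF w]
    using assms by (simp add: ext_flux_eq_flux1 flux1_def joined1_iff)
  then show ?thesis
    using assms by (simp add: left_state_def joined1_iff prod_eq_iff)
qed

lemma continuous_on_left_state:
  assumes f: "continuous_on S f" and k: "continuous_on S k"
    and sub: "\<And>x. x \<in> S \<Longrightarrow> f x \<in> subsonic g" and q: "\<And>x. x \<in> S \<Longrightarrow> k x < sonic_flux (f x)"
  shows "continuous_on S (\<lambda>x. left_state (f x) (k x))"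
proof -
  have pos: "0 < fst (f x)" "0 < height_of_flux g (f x) (k x)" if "x \<in> S" for x
    using left_state_of_flux(1)[OF sub[OF that] q[OF that]] sonic_height_bounds[OF sub[OF that]]
    by (auto simp: left_state_def)
  show ?thesis
    unfolding left_state_def
    by (intro continuous_on_Pair continuous_on_L1 continuous_on_height_of_flux f k sub pos)
qed

definition weir_law :: "real \<Rightarrow> real" where
  "weir_law d = d * sqrt \<bar>d\<bar>"

lemma weir_law_mono: assumes "a \<le> b" shows "weir_law a \<le> weir_law b"
proof -
  consider "0 \<le> a" | "a \<le> 0" "0 \<le> b" | "b \<le> 0" using assms by linarith
  then show ?thesis
  proof cases
    case 1 then show ?thesis using assms by (auto simp: weir_law_def intro!: mult_mono)
  next
    case 2
    have "a * sqrt \<bar>a\<bar> \<le> 0" using 2 by (simp add: mult_nonpos_nonneg)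
    also have "0 \<le> b * sqrt \<bar>b\<bar>" using 2 by simp
    finally show ?thesis by (simp add: weir_law_def)
  next
    case 3
    have "(-b) * sqrt \<bar>b\<bar> \<le> (-a) * sqrt \<bar>a\<bar>"
      using 3 assms by (intro mult_mono) auto
    then show ?thesis by (simp add: weir_law_def)
  qed
qed

lemma continuous_on_weir_law: "continuous_on S f \<Longrightarrow> continuous_on S (\<lambda>x. weir_law (f x))"
  unfolding weir_law_def by (intro continuous_intros)

text \<open>Its zeros are the discharges for which the coupling condition holds between the traces determined
by the data \<open>d\<close>.\<close>

definition residual :: "real \<Rightarrow> real \<Rightarrow> real \<Rightarrow> state \<times> state \<Rightarrow> real \<Rightarrow> real" where
  "residual C Hm Hp d q = q - C * weir_law
     (pos_part (height_of_flux g (fst d) q - Hm)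
      - pos_part (height_of_flux g (mirror (snd d)) (- q) - Hp))"

lemma residual_mirror:
  "residual C Hm Hp (a, b) (- q) = - residual C Hp Hm (mirror b, mirror a) q"
proof -
  have "weir_law (x - y) = - weir_law (y - x)" for x y
    by (simp add: weir_law_def abs_minus_commute algebra_simps)
  from this[of "pos_part (height_of_flux g a (- q) - Hm)"] show ?thesis
    by (simp add: residual_def)
qed

lemma strict_mono_residual:
  assumes C: "0 \<le> C" and "a \<in> subsonic g" "b \<in> subsonic g"
  shows "strict_mono (residual C Hm Hp (a, b))"
proof (rule strict_monoI)
  fix q q' :: real assume q: "q < q'"
  have "height_of_flux g a q' < height_of_flux g a q"
    "height_of_flux g (mirror b) (- q) < height_of_flux g (mirror b) (- q')"
    using assms q by (auto intro!: height_of_flux_strict_decreasing)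
  then have "C * weir_law (pos_part (height_of_flux g a q' - Hm)
        - pos_part (height_of_flux g (mirror b) (- q') - Hp))
     \<le> C * weir_law (pos_part (height_of_flux g a q - Hm)
        - pos_part (height_of_flux g (mirror b) (- q) - Hp))"
    by (intro mult_left_mono weir_law_mono C) (auto simp: pos_part_def)
  then show "residual C Hm Hp (a, b) q < residual C Hm Hp (a, b) q'"
    using q by (simp add: residual_def)
qed

lemma continuous_on_residual:
  assumes f: "continuous_on S f" and k: "continuous_on S k"
    and sub: "\<And>x. x \<in> S \<Longrightarrow> f x \<in> subsonic g \<times> subsonic g"
  shows "continuous_on S (\<lambda>x. residual C Hm Hp (f x) (k x))"
proof -
  have "fst (f x) \<in> subsonic g" "mirror (snd (f x)) \<in> subsonic g" if "x \<in> S" for x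
    using sub[OF that] by (auto simp: mem_Times_iff)
  then show ?thesis
    unfolding residual_def pos_part_def
    by (intro continuous_intros continuous_on_weir_law continuous_on_height_of_flux f k) auto
qed

text \<open>At the critical discharge the left trace has the critical height \<open>h\<close>, so the overflow is at most \<open>h\<close>
and the weir lets through at most \<open>C h \<surd>h\<close>, less than the critical discharge \<open>h \<surd>(g h)\<close>.\<close>

lemma residual_sonic_pos:
  assumes C: "0 \<le> C" "C < sqrt g" and H: "0 \<le> Hm" and a: "a \<in> subsonic g"
  shows "0 < residual C Hm Hp (a, b) (sonic_flux a)"
proof -
  let ?h = "sonic_height g a"
  have h: "0 < ?h" using sonic_height_bounds[OF a] by simp
  have "C * weir_law (pos_part (?h - Hm) - pos_part (height_of_flux g (mirror b) (- sonic_flux a) - Hp))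
      \<le> C * weir_law ?h"
    using h H by (intro mult_left_mono weir_law_mono C) (auto simp: pos_part_def)
  also have "\<dots> < sqrt g * weir_law ?h"
    using C h by (intro mult_strict_right_mono) (auto simp: weir_law_def)
  also have "\<dots> = sonic_flux a"
    using h by (simp add: weir_law_def sonic_flux_def real_sqrt_mult flip: sqrt_sonic_height[OF a])
  finally show ?thesis
    by (simp add: residual_def height_of_sonic_flux[OF a])
qed

lemma residual_root:
  assumes C: "0 \<le> C" "C < sqrt g" and H: "0 \<le> Hm" "0 \<le> Hp"
    and a: "a \<in> subsonic g" and b: "b \<in> subsonic g"
  obtains q where "residual C Hm Hp (a, b) q = 0" "q < sonic_flux a" "- q < sonic_flux (mirror b)"
proof -
  let ?R = "residual C Hm Hp (a, b)"
  have lo: "?R (- sonic_flux (mirror b)) < 0"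
    using residual_sonic_pos[OF C H(2), of "mirror b" Hm "mirror a"] b by (simp add: residual_mirror)
  have hi: "0 < ?R (sonic_flux a)"
    by (rule residual_sonic_pos[OF C H(1) a])
  have le: "- sonic_flux (mirror b) \<le> sonic_flux a"
    using sonic_flux_pos[OF a] sonic_flux_pos[of "mirror b"] b by simp
  have "continuous_on {- sonic_flux (mirror b)..sonic_flux a} ?R"
    using a b by (intro continuous_on_residual continuous_intros) auto
  from IVT'[OF less_imp_le[OF lo] less_imp_le[OF hi] le this]
  obtain q where q: "?R q = 0" by blast
  have "q < sonic_flux a" "- sonic_flux (mirror b) < q"
    using lo hi q strict_mono_less[OF strict_mono_residual[OF C(1) a b]] by metis+
  then show ?thesis using that q by simp
qed

definition weir_discharge :: "real \<Rightarrow> real \<Rightarrow> real \<Rightarrow> state \<times> state \<Rightarrow> real" where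
  "weir_discharge C Hm Hp d = (THE q. residual C Hm Hp d q = 0)"

lemma weir_discharge:
  assumes "0 \<le> C" "C < sqrt g" "0 \<le> Hm" "0 \<le> Hp" and "a \<in> subsonic g" "b \<in> subsonic g"
  shows "residual C Hm Hp (a, b) q = 0 \<longleftrightarrow> q = weir_discharge C Hm Hp (a, b)"
    and "weir_discharge C Hm Hp (a, b) < sonic_flux a"
    and "- weir_discharge C Hm Hp (a, b) < sonic_flux (mirror b)"
proof -
  obtain r where r: "residual C Hm Hp (a, b) r = 0" "r < sonic_flux a" "- r < sonic_flux (mirror b)"
    using residual_root[OF assms] .
  have iff: "residual C Hm Hp (a, b) q = 0 \<longleftrightarrow> q = r" for q
    using r(1) strict_mono_eq[OF strict_mono_residual[OF assms(1,5,6)]] by metis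
  then have "weir_discharge C Hm Hp (a, b) = r"
    by (simp add: weir_discharge_def)
  with iff r show "residual C Hm Hp (a, b) q = 0 \<longleftrightarrow> q = weir_discharge C Hm Hp (a, b)"
    "weir_discharge C Hm Hp (a, b) < sonic_flux a"
    "- weir_discharge C Hm Hp (a, b) < sonic_flux (mirror b)"
    by auto
qed

lemma continuous_on_weir_discharge:
  assumes "0 \<le> C" "C < sqrt g" "0 \<le> Hm" "0 \<le> Hp"
  shows "continuous_on (subsonic g \<times> subsonic g) (weir_discharge C Hm Hp)"
proof (rule continuous_on_root[where F = "residual C Hm Hp"])
  show "continuous_on (subsonic g \<times> subsonic g) (\<lambda>d. residual C Hm Hp d q)" for q
    by (intro continuous_on_residual continuous_intros) auto
qed (use assms strict_mono_residual weir_discharge(1)[OF assms] in auto)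

lemma coupling_iff_weir_law:
  "coupling C Hm Hp a b \<longleftrightarrow>
     fst a * snd a = C * weir_law (pos_part (fst a - Hm) - pos_part (fst b - Hp)) \<and>
     fst b * snd b = fst a * snd a"
  by (cases a; cases b) (simp add: weir_law_def mult.assoc)

section \<open>Solutions at the weir\<close>

lemma glued_traces_eq:
  assumes ass: "0 \<le> C" "C < sqrt g" "0 \<le> Hm" "0 \<le> Hp"
    and wl: "wl \<in> subsonic g" and wr: "wr \<in> subsonic g"
    and m: "joined1 g wl m" "sonic_height g wl \<le> fst m"
    and p: "joined2 g p wr" "sonic_height g (mirror wr) \<le> fst p"
    and c: "coupling C Hm Hp m p"
  shows "m = left_state wl (weir_discharge C Hm Hp (wl, wr))"
    and "p = mirror (left_state (mirror wr) (- weir_discharge C Hm Hp (wl, wr)))"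
proof -
  let ?q = "fst m * snd m"
  have 1: "m = left_state wl ?q"
    by (rule left_state_eqI[OF wl m])
  have "mirror p = left_state (mirror wr) (fst (mirror p) * snd (mirror p))"
    using wr p by (intro left_state_eqI) (auto simp: joined2_mirror)
  then have 2: "mirror p = left_state (mirror wr) (- ?q)"
    using c by (simp add: coupling_iff_weir_law)
  have "fst m = height_of_flux g wl ?q" "fst p = height_of_flux g (mirror wr) (- ?q)"
    using arg_cong[OF 1, of fst] arg_cong[OF 2, of fst] by (auto simp: left_state_def)
  then have "residual C Hm Hp (wl, wr) ?q = 0"
    using c by (simp add: coupling_iff_weir_law residual_def)
  then have q: "?q = weir_discharge C Hm Hp (wl, wr)"
    using weir_discharge(1)[OF ass wl wr] by simp
  show "m = left_state wl (weir_discharge C Hm Hp (wl, wr))" using 1 q by simp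
  show "p = mirror (left_state (mirror wr) (- weir_discharge C Hm Hp (wl, wr)))"
    using 2 q by (metis mirror_simps(3))
qed

lemma weir_discharge_states:
  fixes wl wr C Hm Hp
  defines "q \<equiv> weir_discharge C Hm Hp (wl, wr)"
  defines "m \<equiv> left_state wl q" and "p \<equiv> mirror (left_state (mirror wr) (- q))"
  assumes ass: "0 \<le> C" "C < sqrt g" "0 \<le> Hm" "0 \<le> Hp"
    and wl: "wl \<in> subsonic g" and wr: "wr \<in> subsonic g"
  shows "joined1 g wl m" "sonic_height g wl \<le> fst m"
    and "joined2 g p wr" "sonic_height g (mirror wr) \<le> fst p"
    and "coupling C Hm Hp m p"
proof -
  have wr': "mirror wr \<in> subsonic g" using wr by simp
  note d = weir_discharge[OF ass wl wr, folded q_def]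
  note l = left_state_of_flux[OF wl d(2), folded m_def]
  note r = left_state_of_flux[OF wr' d(3)]
  show "joined1 g wl m" "sonic_height g wl \<le> fst m" using l by auto
  show "joined2 g p wr" "sonic_height g (mirror wr) \<le> fst p"
    using r by (auto simp: joined2_mirror p_def)
  have "fst m = height_of_flux g wl q" "fst p = height_of_flux g (mirror wr) (- q)"
    by (auto simp: m_def p_def left_state_def)
  moreover have "residual C Hm Hp (wl, wr) q = 0" using d(1) by simp
  ultimately show "coupling C Hm Hp m p"
    using l(3) r(3) by (simp add: coupling_iff_weir_law residual_def p_def)
qed

text \<open>With the traces themselves as middle states, each half of the solution is a single wave, and the
Lax solutions on both sides have the prescribed limits at the weir.\<close>

lemma weir_solution_exists:
  assumes wl: "wl \<in> subsonic g" and wr: "wr \<in> subsonic g"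
    and m: "joined1 g wl m" "sonic_height g wl \<le> fst m"
    and p: "joined2 g p wr" "sonic_height g (mirror wr) \<le> fst p"
    and c: "coupling C Hm Hp m p"
  obtains u where "weir_solution g C Hm Hp wl wr u m p"
proof
  define u where "u t x = (if x < 0 then lax_function wl m m t x else lax_function p wr p t x)" for t x :: real
  have pos: "0 < fst m" "0 < fst p"
    using sonic_height_bounds[OF wl] sonic_height_bounds[of "mirror wr"] wr m(2) p(2) by auto
  have lm: "(lax_function wl m m t \<longlongrightarrow> m) (at_left 0)" if "t > 0" for t
    using profile_left_limit[OF wl m] that by (rule lax_function_left_limit)
  have "(profile p wr p \<longlongrightarrow> p) (at_right 0)"
    using profile_left_limit[of "mirror wr" "mirror p"] wr p
    by (simp add: right_limit_mirror joined1_refl joined2_mirror)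
  then have rp: "(lax_function p wr p t \<longlongrightarrow> p) (at_right 0)" if "t > 0" for t
    using that by (rule lax_function_right_limit)
  have "(u t \<longlongrightarrow> m) (at_left 0)" if "t > 0" for t
    by (rule Lim_transform_eventually[OF lm[OF that]])
       (simp add: u_def eventually_at_filter)
  moreover have "(u t \<longlongrightarrow> p) (at_right 0)" if "t > 0" for t
    by (rule Lim_transform_eventually[OF rp[OF that]])
       (simp add: u_def eventually_at_filter)
  moreover have "self_similar u"
    by (auto simp: self_similar_def u_def lax_function_def mult_less_0_iff)
  moreover have "lax_solution g wl m (lax_function wl m m)"
    using pos m by (intro lax_solution_lax_function joined2_refl)
  moreover have "lax_solution g p wr (lax_function p wr p)"
    using pos p by (intro lax_solution_lax_function joined1_refl)
  ultimately show "weir_solution g C Hm Hp wl wr u m p"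
    unfolding weir_solution_def using pos c
    by (intro conjI allI impI exI[of _ "lax_function wl m m"] exI[of _ "lax_function p wr p"])
       (auto simp: u_def)
qed

text \<open>Both kinds of admissible solutions, glued ones and those with subsonic traces, turn out to consist
of a 1-wave on the left and a 2-wave on the right.\<close>

lemma weir_solution_traces:
  assumes wl: "wl \<in> subsonic g" and wr: "wr \<in> subsonic g"
    and u: "weir_solution g C Hm Hp wl wr u m p"
    and gl: "glued g C Hm Hp wl wr m p \<or> m \<in> subsonic g \<and> p \<in> subsonic g"
  shows "joined1 g wl m" "sonic_height g wl \<le> fst m"
    and "joined2 g p wr" "sonic_height g (mirror wr) \<le> fst p"
    and "coupling C Hm Hp m p"
proof -
  obtain U V where U: "lax_solution g wl m U" "\<forall>t\<ge>0. \<forall>x<0. u t x = U t x"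
    and V: "lax_solution g p wr V" "\<forall>t\<ge>0. \<forall>x>0. u t x = V t x"
    using u unfolding weir_solution_def by blast
  have pos: "0 < fst m" "0 < fst p" and lim: "(u 1 \<longlongrightarrow> m) (at_left 0)" "(u 1 \<longlongrightarrow> p) (at_right 0)"
    and c: "coupling C Hm Hp m p"
    using u by (auto simp: weir_solution_def)
  have "(U 1 \<longlongrightarrow> m) (at_left 0)"
    by (rule Lim_transform_eventually[OF lim(1)]) (use U in \<open>simp add: eventually_at_filter\<close>)
  moreover have "(V 1 \<longlongrightarrow> p) (at_right 0)"
    by (rule Lim_transform_eventually[OF lim(2)]) (use V in \<open>simp add: eventually_at_filter\<close>)
  ultimately show "joined1 g wl m" "sonic_height g wl \<le> fst m"
    "joined2 g p wr" "sonic_height g (mirror wr) \<le> fst p"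
    using left_trace[OF wl pos(1) U(1)] right_trace[OF wr pos(2) V(1)] gl
    by (auto simp: glued_def)
  show "coupling C Hm Hp m p" by (rule c)
qed

lemma weir_solution_determined_by_traces:
  assumes wl: "wl \<in> subsonic g" and wr: "wr \<in> subsonic g"
    and u: "weir_solution g C Hm Hp wl wr u m p" and u': "weir_solution g C Hm Hp wl wr u' m p"
    and t: "t \<ge> 0" and x: "x \<noteq> 0"
  shows "u' t x = u t x"
proof -
  obtain U V where U: "lax_solution g wl m U" "\<forall>t\<ge>0. \<forall>x<0. u t x = U t x"
    and V: "lax_solution g p wr V" "\<forall>t\<ge>0. \<forall>x>0. u t x = V t x"
    using u unfolding weir_solution_def by blast
  obtain U' V' where U': "lax_solution g wl m U'" "\<forall>t\<ge>0. \<forall>x<0. u' t x = U' t x"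
    and V': "lax_solution g p wr V'" "\<forall>t\<ge>0. \<forall>x>0. u' t x = V' t x"
    using u' unfolding weir_solution_def by blast
  have pos: "0 < fst m" "0 < fst p" "0 < fst wl" "0 < fst wr"
    using u wl wr by (auto simp: weir_solution_def subsonic_iff)
  show ?thesis
  proof (cases "x < 0")
    case True
    then show ?thesis using U U' t lax_solution_unique[OF pos(3,1) U'(1) U(1) t] by simp
  next
    case False
    then show ?thesis using V V' t x lax_solution_unique[OF pos(2,4) V'(1) V(1) t] by simp
  qed
qed

end

theorem proposition2p3:
  fixes g C Hm Hp :: real
  assumes "g > 0" and "C = 0.6 * sqrt g" and "Hm > 0" and "Hp > 0"
  shows "\<exists>Wm Wp :: state \<times> state \<Rightarrow> state.
    continuous_on (subsonic g \<times> subsonic g) Wm \<and>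
    continuous_on (subsonic g \<times> subsonic g) Wp \<and>
    (\<forall>wl \<in> subsonic g. \<forall>wr \<in> subsonic g.
      glued g C Hm Hp wl wr (Wm (wl, wr)) (Wp (wl, wr)) \<and>
      (\<exists>u. weir_solution g C Hm Hp wl wr u (Wm (wl, wr)) (Wp (wl, wr)) \<and>
        (\<forall>u' wm wp. weir_solution g C Hm Hp wl wr u' wm wp \<and>
            (glued g C Hm Hp wl wr wm wp \<or> wm \<in> subsonic g \<and> wp \<in> subsonic g) \<longrightarrow>
            wm = Wm (wl, wr) \<and> wp = Wp (wl, wr) \<and>
            (\<forall>t\<ge>0. \<forall>x. x \<noteq> 0 \<longrightarrow> u' t x = u t x))))"
proof -
  note g = \<open>g > 0\<close>
  have ass: "0 \<le> C" "C < sqrt g" "0 \<le> Hm" "0 \<le> Hp"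
    using assms(3,4) real_sqrt_gt_zero[OF g] unfolding assms(2) by auto
  define q where "q = weir_discharge g C Hm Hp"
  define Wm where "Wm d = left_state g (fst d) (q d)" for d
  define Wp where "Wp d = mirror (left_state g (mirror (snd d)) (- q d))" for d
  let ?S = "subsonic g \<times> subsonic g"
  have q: "continuous_on ?S q"
    unfolding q_def by (rule continuous_on_weir_discharge[OF g ass])
  have lt: "q d < sonic_flux g (fst d)" "- q d < sonic_flux g (mirror (snd d))" if "d \<in> ?S" for d
    using weir_discharge(2,3)[OF g ass, of "fst d" "snd d"] that by (auto simp: q_def)
  have "continuous_on ?S Wm"
    unfolding Wm_def using lt
    by (intro continuous_on_left_state[OF g] continuous_intros q) auto
  moreover have "continuous_on ?S Wp"
    unfolding Wp_def using lt
    by (intro continuous_on_mirror continuous_on_left_state[OF g] continuous_intros q) auto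
  moreover have "glued g C Hm Hp wl wr (Wm (wl, wr)) (Wp (wl, wr)) \<and>
      (\<exists>u. weir_solution g C Hm Hp wl wr u (Wm (wl, wr)) (Wp (wl, wr)) \<and>
        (\<forall>u' wm wp. weir_solution g C Hm Hp wl wr u' wm wp \<and>
            (glued g C Hm Hp wl wr wm wp \<or> wm \<in> subsonic g \<and> wp \<in> subsonic g) \<longrightarrow>
            wm = Wm (wl, wr) \<and> wp = Wp (wl, wr) \<and>
            (\<forall>t\<ge>0. \<forall>x. x \<noteq> 0 \<longrightarrow> u' t x = u t x)))"
    if wl: "wl \<in> subsonic g" and wr: "wr \<in> subsonic g" for wl wr
  proof -
    let ?m = "Wm (wl, wr)" and ?p = "Wp (wl, wr)"
    have st: "joined1 g wl ?m" "sonic_height g wl \<le> fst ?m"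
      "joined2 g ?p wr" "sonic_height g (mirror wr) \<le> fst ?p" "coupling C Hm Hp ?m ?p"
      using weir_discharge_states[OF g ass wl wr] by (simp_all add: Wm_def Wp_def q_def)
    obtain u where u: "weir_solution g C Hm Hp wl wr u ?m ?p"
      using weir_solution_exists[OF g wl wr st] .
    have traces: "wm = ?m" "wp = ?p"
      if "weir_solution g C Hm Hp wl wr u' wm wp"
        "glued g C Hm Hp wl wr wm wp \<or> wm \<in> subsonic g \<and> wp \<in> subsonic g" for u' wm wp
      using glued_traces_eq[OF g ass wl wr weir_solution_traces[OF g wl wr that]]
      by (simp_all add: Wm_def Wp_def q_def)
    have "wm = ?m \<and> wp = ?p \<and> (\<forall>t\<ge>0. \<forall>x. x \<noteq> 0 \<longrightarrow> u' t x = u t x)"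
      if u': "weir_solution g C Hm Hp wl wr u' wm wp \<and>
        (glued g C Hm Hp wl wr wm wp \<or> wm \<in> subsonic g \<and> wp \<in> subsonic g)" for u' wm wp
    proof -
      have eq: "wm = ?m" "wp = ?p" using traces u' by blast+
      then have "weir_solution g C Hm Hp wl wr u' ?m ?p" using u' by simp
      from weir_solution_determined_by_traces[OF g wl wr u this] show ?thesis
        using eq by blast
    qed
    moreover have "glued g C Hm Hp wl wr ?m ?p" using st by (simp add: glued_def)
    ultimately show ?thesis using u by blast
  qed
  ultimately show ?thesis by blast
qed

end
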